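(* Let $1\le k\le n$ be integers, let $f:[0,\infty)\to(0,\infty)$ and $g:(-\infty,0]\to(0,\infty)$ be continuous and periodic with minimal positive periods $T_f$ and $T_g$ respectively, i.e. $f(r+T_f)=f(r)$ for all $r\ge0$ and $g(t-T_g)=g(t)$ for all $t\le0$. Suppose $\alpha>\max\{0,\frac{2k-n}{kn}\}$. Let $u(x,t)=w(t)v(|x|)$ be the constructed separable solution of $-u_t(\sigma_k(\lambda(D^2u)))^{\alpha}=f(|x|)g(t)$ in $\mathbb{R}^n\times(-\infty,0]$ (defined in the context). Then there are a constant $C_w$ dependent only on $k,\alpha$ and $g$, and a constant $C_v$ dependent only on $n,k,\alpha$ and $f$, such that $$w(t)=C_w(-t)^{\frac{1}{k\alpha+1}}+O\Bigl((-t)^{\frac{1}{k\alpha+1}-1}\Bigr)\quad\text{as }t\to-\infty,$$ $$v(r)=C_v r^{\frac{2k\alpha}{k\alpha+1}}+o\Bigl(r^{\frac{2k\alpha}{k\alpha+1}}\Bigr)\quad\text{as }r\to\infty.$$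
   Context: $\sigma_k$ is the $k$-th elementary symmetric function, $\lambda(D^2u)$ the eigenvalues of the Hessian of $u$ in $x$, and $C_n^k=\binom{n}{k}$. For $\alpha>0$, the constructed separable solution is $u(x,t)=w(t)v(|x|)$, where $$w(t)=(k\alpha+1)^{\frac1{k\alpha+1}}\Bigl(1+\int_t^0 g(s)\,ds\Bigr)^{\frac1{k\alpha+1}},\quad t\le0,$$ and $v\in C^2([0,\infty))$, $v>0$, is the unique solution of the initial value problem $$v'(r)=\Bigl(\frac{n r^{k-n}}{C_n^k}\int_0^r s^{n-1}\Bigl(\frac{f(s)}{v(s)}\Bigr)^{1/\alpha}ds\Bigr)^{1/k}\ (r>0),\qquad v(0)=1.$$ *)

theory Defs
  imports "HOL-Analysis.Analysis" "HOL-Library.Landau_Symbols"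
begin

text \<open>Functions on \<open>[0,\<infinity>)\<close> or \<open>(-\<infinity>,0]\<close> are represented by functions on all reals whose values
  outside the half-line are never constrained.\<close>

definition period_right :: "(real \<Rightarrow> real) \<Rightarrow> real \<Rightarrow> bool" where
  "period_right f T \<longleftrightarrow> T > 0 \<and> (\<forall>r\<ge>0. f (r + T) = f r)"

definition period_left :: "(real \<Rightarrow> real) \<Rightarrow> real \<Rightarrow> bool" where
  "period_left g T \<longleftrightarrow> T > 0 \<and> (\<forall>t\<le>0. g (t - T) = g t)"

definition minimal_period_right :: "(real \<Rightarrow> real) \<Rightarrow> real \<Rightarrow> bool" where
  "minimal_period_right f T \<longleftrightarrow> period_right f T \<and> (\<forall>T'. period_right f T' \<longrightarrow> T \<le> T')"

definition minimal_period_left :: "(real \<Rightarrow> real) \<Rightarrow> real \<Rightarrow> bool" where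
  "minimal_period_left g T \<longleftrightarrow> period_left g T \<and> (\<forall>T'. period_left g T' \<longrightarrow> T \<le> T')"

text \<open>\<open>C\<^sup>2([0,\<infinity>))\<close>, with one-sided derivatives at \<open>0\<close>.\<close>

definition C2_right :: "(real \<Rightarrow> real) \<Rightarrow> bool" where
  "C2_right v \<longleftrightarrow> (\<exists>v' v''.
     (\<forall>r\<ge>0. (v has_real_derivative v' r) (at r within {0..})) \<and>
     (\<forall>r\<ge>0. (v' has_real_derivative v'' r) (at r within {0..})) \<and>
     continuous_on {0..} v'')"

text \<open>The separable solution of \<open>- u\<^sub>t (\<sigma>\<^sub>k(\<lambda>(D\<^sup>2u)))\<^sup>\<alpha> = f(|x|) g(t)\<close> on \<open>\<real>\<^sup>n \<times> (-\<infinity>,0]\<close> is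
  \<open>u(x,t) = w(t) v(|x|)\<close>, where \<open>w\<close> is \<open>time_factor k \<alpha> g\<close> and \<open>v\<close> satisfies
  \<open>radial_factor n k \<alpha> f v\<close>, an initial value problem that determines \<open>v\<close> on \<open>[0,\<infinity>)\<close>.\<close>

definition time_factor :: "nat \<Rightarrow> real \<Rightarrow> (real \<Rightarrow> real) \<Rightarrow> real \<Rightarrow> real" where
  "time_factor k \<alpha> g t =
     (real k * \<alpha> + 1) powr (1 / (real k * \<alpha> + 1)) *
     (1 + integral {t..0} g) powr (1 / (real k * \<alpha> + 1))"

definition radial_factor ::
  "nat \<Rightarrow> nat \<Rightarrow> real \<Rightarrow> (real \<Rightarrow> real) \<Rightarrow> (real \<Rightarrow> real) \<Rightarrow> bool" where
  "radial_factor n k \<alpha> f v \<longleftrightarrow>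
     C2_right v \<and> (\<forall>r\<ge>0. v r > 0) \<and> v 0 = 1 \<and>
     (\<forall>r>0. (v has_real_derivative
        (real n * r powr (real k - real n) / real (n choose k) *
          integral {0..r} (\<lambda>s. s ^ (n - 1) * (f s / v s) powr (1 / \<alpha>))) powr (1 / real k))
        (at r))"

end

theory Submission
  imports Defs
begin

text \<open>The time factor is explicit. The integral of a periodic function differs from the mean times the
length of the interval by a bounded amount (\<open>periodic_integral_near_linear\<close>), and
\<open>x powr \<beta>\<close> with \<open>\<beta> = 1 / (k \<alpha> + 1)\<close> has Lipschitz constant \<open>O(s powr (\<beta> - 1))\<close> at
height \<open>s\<close>; together these give the error \<open>O(s powr (\<beta> - 1))\<close> with \<open>s = - t\<close>.

For the radial factor put \<open>p = 1 / \<alpha>\<close>, \<open>\<gamma> = 2 k \<alpha> / (k \<alpha> + 1)\<close> and \<open>\<delta> = n - p \<gamma>\<close>; the lower bound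
on \<open>\<alpha>\<close> says exactly that \<open>\<delta> > 0\<close>. If \<open>f\<^sup>p\<close> were constantly equal to its mean \<open>F\<close>, then for one
constant \<open>C\<close> the powers \<open>C r\<^sup>\<gamma>\<close> and \<open>D r\<^sup>\<delta>\<close>, \<open>D = (C \<gamma>)\<^sup>k\<close>, would balance the equation, as \<open>v\<close> and as
the multiple \<open>n / (n choose k)\<close> of the integral in it. Dividing the true \<open>v\<close> and the true
integral by these powers and setting \<open>r = exp t\<close> turns the problem into the planar system
\<open>X' = \<gamma> (Y\<^sup>1\<^sup>/\<^sup>k - X)\<close>, \<open>Y' = \<delta> (H X\<^sup>-\<^sup>p - Y)\<close> with \<open>H t = f (exp t)\<^sup>p / F\<close>, and the claim is \<open>X \<rightarrow> 1\<close>.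

This is a feedback loop: \<open>Y\<close> drives \<open>X\<close> up and \<open>X\<close> drives \<open>Y\<close> down. For \<open>H = 1\<close> the equilibrium
\<open>(1, 1)\<close> attracts everything, since the sum of the two integrals of \<open>(z\<^sup>1\<^sup>/\<^sup>k - 1) / \<delta>\<close> up to \<open>Y\<close> and
of \<open>(1 - x\<^sup>-\<^sup>p) / \<gamma>\<close> up to \<open>X\<close> is a Lyapunov function: in its derivative the mixed terms cancel, and
because both integrals are convex it decays at an exponential rate. The argument survives errors
that tend to \<open>0\<close> (\<open>feedback_loop_tendsto\<close>).

The actual \<open>H\<close> does not tend to \<open>1\<close>; it oscillates faster and faster in \<open>t\<close>. What makes this
harmless is that \<open>H - 1\<close> has a small corrector: \<open>Q\<close> with \<open>Q' + Q = H - 1\<close> and \<open>Q \<rightarrow> 0\<close>, namely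
\<open>exp (- t)\<close> times the bounded deviation of the integral of \<open>f\<^sup>p\<close> from linear growth. Replacing \<open>Y\<close>
by \<open>Y - \<delta> Q X\<^sup>-\<^sup>p\<close> absorbs the oscillation into vanishing errors
(\<open>oscillating_power_loop_tendsto\<close>), provided the orbit stays in a compact part of the open
quadrant, which follows from one-dimensional comparison arguments (\<open>power_loop_permanence\<close>).\<close>

section \<open>Differential inequalities\<close>

text \<open>The factor \<open>exp (\<mu> t)\<close> makes \<open>q - \<beta>\<close> nondecreasing. Everything quantitative about orbits below is
extracted from this scalar inequality.\<close>

lemma comparison_lower:
  fixes q :: "real \<Rightarrow> real"
  assumes "\<And>t. t \<ge> t0 \<Longrightarrow> (q has_real_derivative q' t) (at t)"
    and "\<And>t. t \<ge> t0 \<Longrightarrow> q' t \<ge> \<mu> * (\<beta> - q t)" and "\<mu> > 0" "t \<ge> t0"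
  shows "q t \<ge> \<beta> + exp (- \<mu> * (t - t0)) * (q t0 - \<beta>)"
proof -
  define E where "E s = exp (\<mu> * s) * (q s - \<beta>)" for s
  have "E t0 \<le> E t"
  proof (rule DERIV_nonneg_imp_nondecreasing[OF \<open>t \<ge> t0\<close>])
    fix s assume "t0 \<le> s" "s \<le> t"
    have "(E has_real_derivative exp (\<mu> * s) * (q' s - \<mu> * (\<beta> - q s))) (at s)"
      unfolding E_def using \<open>t0 \<le> s\<close>
      by (auto intro!: derivative_eq_intros assms(1) simp: algebra_simps)
    moreover have "exp (\<mu> * s) * (q' s - \<mu> * (\<beta> - q s)) \<ge> 0"
      using assms(2)[OF \<open>t0 \<le> s\<close>] by simp
    ultimately show "\<exists>y. (E has_real_derivative y) (at s) \<and> 0 \<le> y" by blast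
  qed
  then have "exp (\<mu> * t0) * (q t0 - \<beta>) * exp (- \<mu> * t) \<le> exp (\<mu> * t) * (q t - \<beta>) * exp (- \<mu> * t)"
    unfolding E_def by (intro mult_right_mono) auto
  also have "\<dots> = q t - \<beta>" by (simp add: exp_minus)
  also have "exp (\<mu> * t0) * (q t0 - \<beta>) * exp (- \<mu> * t) = exp (- \<mu> * (t - t0)) * (q t0 - \<beta>)"
    by (simp add: algebra_simps flip: exp_add)
  finally show ?thesis by simp
qed

lemma comparison_min:
  fixes q :: "real \<Rightarrow> real"
  assumes "\<And>t. t \<ge> t0 \<Longrightarrow> (q has_real_derivative q' t) (at t)"
    and "\<And>t. t \<ge> t0 \<Longrightarrow> q' t \<ge> \<mu> * (\<beta> - q t)" and "\<mu> > 0" "t \<ge> t0"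
  shows "q t \<ge> min (q t0) \<beta>"
proof -
  have e: "exp (- \<mu> * (t - t0)) \<le> 1" "exp (- \<mu> * (t - t0)) > 0" using assms by auto
  have *: "q t \<ge> \<beta> + exp (- \<mu> * (t - t0)) * (q t0 - \<beta>)" by (rule comparison_lower[OF assms])
  show ?thesis
  proof (cases "q t0 \<ge> \<beta>")
    case True
    then have "exp (- \<mu> * (t - t0)) * (q t0 - \<beta>) \<ge> 0" using e by simp
    then show ?thesis using * by simp
  next
    case False
    then have "exp (- \<mu> * (t - t0)) * (\<beta> - q t0) \<le> 1 * (\<beta> - q t0)"
      using e by (intro mult_right_mono) auto
    then show ?thesis using * by (simp add: algebra_simps)
  qed
qed

lemma comparison_max:
  fixes q :: "real \<Rightarrow> real"
  assumes "\<And>t. t \<ge> t0 \<Longrightarrow> (q has_real_derivative q' t) (at t)"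
    and "\<And>t. t \<ge> t0 \<Longrightarrow> q' t \<le> \<mu> * (\<beta> - q t)" and "\<mu> > 0" "t \<ge> t0"
  shows "q t \<le> max (q t0) \<beta>"
proof -
  have "min (- q t0) (- \<beta>) \<le> - q t"
  proof (rule comparison_min[where q = "\<lambda>s. - q s" and q' = "\<lambda>s. - q' s" and \<mu> = \<mu> and ?t0.0 = t0])
    fix s assume "s \<ge> t0"
    then show "((\<lambda>s. - q s) has_real_derivative - q' s) (at s)"
      by (auto intro!: derivative_intros assms(1))
    show "- q' s \<ge> \<mu> * (- \<beta> - - q s)" using assms(2)[OF \<open>s \<ge> t0\<close>] by (simp add: algebra_simps)
  qed (use assms in auto)
  then show ?thesis by (simp add: min_def max_def split: if_splits)
qed

lemma decay_tendsto_zero: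
  fixes L :: "real \<Rightarrow> real"
  assumes deriv: "\<And>t. t \<ge> t0 \<Longrightarrow> (L has_real_derivative L' t) (at t)"
    and le: "\<And>t. t \<ge> t0 \<Longrightarrow> L' t \<le> - \<mu> * L t + \<epsilon> t"
    and "\<mu> > 0" and nonneg: "\<And>t. t \<ge> t0 \<Longrightarrow> L t \<ge> 0" and \<epsilon>: "(\<epsilon> \<longlongrightarrow> 0) at_top"
  shows "(L \<longlongrightarrow> 0) at_top"
proof (rule tendstoI)
  fix \<eta> :: real assume "\<eta> > 0"
  have "eventually (\<lambda>t. \<epsilon> t < \<mu> * (\<eta> / 2)) at_top"
    using \<open>\<eta> > 0\<close> \<open>\<mu> > 0\<close> by (intro order_tendstoD(2)[OF \<epsilon>]) auto
  then obtain T where T: "\<And>t. t \<ge> T \<Longrightarrow> \<epsilon> t < \<mu> * (\<eta> / 2)" by (auto simp: eventually_at_top_linorder)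
  define t1 where "t1 = max T t0"
  have bound: "L t \<le> \<eta> / 2 + exp (- \<mu> * (t - t1)) * (L t1 - \<eta> / 2)" if "t \<ge> t1" for t
  proof -
    have "- L t \<ge> - (\<eta> / 2) + exp (- \<mu> * (t - t1)) * (- L t1 - - (\<eta> / 2))"
    proof (rule comparison_lower[where q' = "\<lambda>s. - L' s"])
      fix s assume "s \<ge> t1"
      then have s: "s \<ge> t0" "s \<ge> T" by (auto simp: t1_def)
      show "((\<lambda>t. - L t) has_real_derivative - L' s) (at s)"
        using s by (auto intro!: derivative_intros deriv)
      show "\<mu> * (- (\<eta> / 2) - - L s) \<le> - L' s"
        using le[OF s(1)] T[OF s(2)] by (simp add: algebra_simps)
    qed (use that \<open>\<mu> > 0\<close> in auto)
    then show ?thesis by (simp add: algebra_simps)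
  qed
  have shift: "filterlim (\<lambda>t. t - t1) at_top at_top"
    using filterlim_tendsto_add_at_top[OF tendsto_const[of "- t1"] filterlim_ident] by simp
  have "((\<lambda>t. exp (- \<mu> * (t - t1)) * (L t1 - \<eta> / 2)) \<longlongrightarrow> 0 * (L t1 - \<eta> / 2)) at_top"
    using \<open>\<mu> > 0\<close>
    by (intro tendsto_mult tendsto_const filterlim_compose[OF exp_at_bot]
        filterlim_tendsto_neg_mult_at_bot[OF tendsto_const] shift) auto
  then have "eventually (\<lambda>t. exp (- \<mu> * (t - t1)) * (L t1 - \<eta> / 2) < \<eta> / 2) at_top"
    using order_tendstoD(2) \<open>\<eta> > 0\<close> by (metis half_gt_zero mult_zero_left)
  with eventually_ge_at_top[of t1] show "eventually (\<lambda>t. dist (L t) 0 < \<eta>) at_top"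
  proof eventually_elim
    case (elim t)
    then show ?case using bound[OF elim(1)] nonneg[of t] by (auto simp: t1_def)
  qed
qed

lemma tangent_below:
  fixes G :: "real \<Rightarrow> real"
  assumes "\<And>x. x \<in> {a<..<b} \<Longrightarrow> (G has_real_derivative q x) (at x)" "mono_on {a<..<b} q"
    and "x \<in> {a<..<b}" "y \<in> {a<..<b}"
  shows "q x * (y - x) \<le> G y - G x"
proof -
  have "convex_on {a<..<b} G"
    by (rule convex_on_realI[where f' = q]) (use assms in \<open>auto simp: mono_on_def\<close>)
  then show ?thesis
    by (rule convex_on_imp_above_tangent)
       (use assms in \<open>auto intro: has_field_derivative_at_within\<close>)
qed

section \<open>Convergence of a perturbed feedback loop\<close>

text \<open>Let \<open>\<Phi>\<close> and \<open>\<Psi>\<close> be the primitives of \<open>\<phi> - 1\<close> and \<open>1 - \<psi>\<close>; both are convex with minimum at \<open>1\<close>.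
Along the unperturbed flow \<open>\<Phi> (Z) / \<delta> + \<Psi> (X) / \<gamma>\<close> has derivative
\<open>- (\<phi> Z - 1) (Z - 1) - (1 - \<psi> X) (X - 1)\<close>, because the products \<open>\<phi> Z * \<psi> X\<close> cancel. By
convexity these two terms dominate \<open>\<Phi> Z - \<Phi> 1\<close> and \<open>\<Psi> X - \<Psi> 1\<close>, so the Lyapunov function,
normalised to vanish at \<open>(1, 1)\<close>, decays up to the perturbation. Only \<open>\<psi>\<close> has to be strict,
because only the convergence of \<open>X\<close> is claimed.\<close>

lemma feedback_loop_tendsto:
  fixes X Z \<phi> \<psi> e1 e2 :: "real \<Rightarrow> real"
  assumes ab: "a < 1" "1 < b" and pos: "\<gamma> > 0" "\<delta> > 0"
    and cont: "continuous_on {a..b} \<phi>" "continuous_on {a..b} \<psi>"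
    and mono: "mono_on {a..b} \<phi>" "\<And>x y. a \<le> x \<Longrightarrow> x < y \<Longrightarrow> y \<le> b \<Longrightarrow> \<psi> y < \<psi> x"
    and fix1: "\<phi> 1 = 1" "\<psi> 1 = 1"
    and box: "\<And>t. t \<ge> t0 \<Longrightarrow> X t \<in> {a<..<b}" "\<And>t. t \<ge> t0 \<Longrightarrow> Z t \<in> {a<..<b}"
    and dX: "\<And>t. t \<ge> t0 \<Longrightarrow> (X has_real_derivative \<gamma> * (\<phi> (Z t) - X t + e1 t)) (at t)"
    and dZ: "\<And>t. t \<ge> t0 \<Longrightarrow> (Z has_real_derivative \<delta> * (\<psi> (X t) - Z t + e2 t)) (at t)"
    and e: "(e1 \<longlongrightarrow> 0) at_top" "(e2 \<longlongrightarrow> 0) at_top"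
  shows "(X \<longlongrightarrow> 1) at_top"
proof -
  define \<Phi> where "\<Phi> z = integral {a..z} (\<lambda>s. \<phi> s - 1)" for z
  define \<Psi> where "\<Psi> x = integral {a..x} (\<lambda>s. 1 - \<psi> s)" for x
  have d\<Phi>: "(\<Phi> has_real_derivative \<phi> z - 1) (at z)" if "z \<in> {a<..<b}" for z
  proof -
    have "((\<lambda>z. integral {a..z} (\<lambda>s. \<phi> s - 1)) has_real_derivative \<phi> z - 1) (at z within {a..b})"
      using that by (intro integral_has_real_derivative) (auto intro!: continuous_intros cont)
    then show ?thesis using that unfolding \<Phi>_def by (simp add: at_within_Icc_at)
  qed
  have d\<Psi>: "(\<Psi> has_real_derivative 1 - \<psi> x) (at x)" if "x \<in> {a<..<b}" for x
  proof -
    have "((\<lambda>z. integral {a..z} (\<lambda>s. 1 - \<psi> s)) has_real_derivative 1 - \<psi> x) (at x within {a..b})"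
      using that by (intro integral_has_real_derivative) (auto intro!: continuous_intros cont)
    then show ?thesis using that unfolding \<Psi>_def by (simp add: at_within_Icc_at)
  qed
  have t\<Phi>: "(\<phi> x - 1) * (y - x) \<le> \<Phi> y - \<Phi> x" if "x \<in> {a<..<b}" "y \<in> {a<..<b}" for x y
    by (rule tangent_below[OF d\<Phi>]) (use that mono in \<open>auto simp: mono_on_def\<close>)
  have t\<Psi>: "(1 - \<psi> x) * (y - x) \<le> \<Psi> y - \<Psi> x" if "x \<in> {a<..<b}" "y \<in> {a<..<b}" for x y
  proof (rule tangent_below[OF d\<Psi>])
    show "mono_on {a<..<b} (\<lambda>x. 1 - \<psi> x)"
    proof (rule mono_onI)
      fix r s assume "r \<in> {a<..<b}" "s \<in> {a<..<b}" "r \<le> s"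
      then show "1 - \<psi> r \<le> 1 - \<psi> s" using mono(2)[of r s] by (cases "r = s") auto
    qed
  qed (use that in auto)
  have one: "1 \<in> {a<..<b}" using ab by simp
  define L where "L t = (\<Phi> (Z t) - \<Phi> 1) / \<delta> + (\<Psi> (X t) - \<Psi> 1) / \<gamma>" for t
  define \<epsilon> where "\<epsilon> t = (\<phi> (Z t) - 1) * e2 t + (1 - \<psi> (X t)) * e1 t" for t
  define \<mu> where "\<mu> = min \<gamma> \<delta>"
  have "\<mu> > 0" using pos by (simp add: \<mu>_def)
  have \<Phi>_nonneg: "\<Phi> z - \<Phi> 1 \<ge> 0" if "z \<in> {a<..<b}" for z using t\<Phi>[OF one that] fix1 by simp
  have \<Psi>_nonneg: "\<Psi> z - \<Psi> 1 \<ge> 0" if "z \<in> {a<..<b}" for z using t\<Psi>[OF one that] fix1 by simp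
  have L_ge: "L t \<ge> (\<Psi> (X t) - \<Psi> 1) / \<gamma>" if "t \<ge> t0" for t
    using \<Phi>_nonneg[OF box(2)[OF that]] pos by (simp add: L_def)
  have bd: "bounded (\<phi> ` {a..b})" "bounded (\<psi> ` {a..b})"
    using cont by (auto intro!: compact_imp_bounded compact_continuous_image)
  (* the coefficients of e1 and e2 in the derivative of L are bounded on the box *)
  obtain M1 where M1: "\<And>x. x \<in> {a..b} \<Longrightarrow> \<bar>\<phi> x\<bar> \<le> M1" using bd(1) by (force simp: bounded_iff)
  obtain M2 where M2: "\<And>x. x \<in> {a..b} \<Longrightarrow> \<bar>\<psi> x\<bar> \<le> M2" using bd(2) by (force simp: bounded_iff)
  have "(L \<longlongrightarrow> 0) at_top"
  proof (rule decay_tendsto_zero[where L' = "\<lambda>t. - (\<phi> (Z t) - 1) * (Z t - 1) - (1 - \<psi> (X t)) * (X t - 1) + \<epsilon> t"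
        and \<mu> = \<mu> and \<epsilon> = \<epsilon> and ?t0.0 = t0])
    fix t assume t: "t \<ge> t0"
    have "((\<lambda>t. \<Phi> (Z t)) has_real_derivative (\<phi> (Z t) - 1) * (\<delta> * (\<psi> (X t) - Z t + e2 t))) (at t)"
      by (rule DERIV_chain2[OF d\<Phi>[OF box(2)[OF t]] dZ[OF t]])
    moreover have "((\<lambda>t. \<Psi> (X t)) has_real_derivative (1 - \<psi> (X t)) * (\<gamma> * (\<phi> (Z t) - X t + e1 t))) (at t)"
      by (rule DERIV_chain2[OF d\<Psi>[OF box(1)[OF t]] dX[OF t]])
    ultimately have "(L has_real_derivative
        ((\<phi> (Z t) - 1) * (\<delta> * (\<psi> (X t) - Z t + e2 t))) / \<delta>
        + ((1 - \<psi> (X t)) * (\<gamma> * (\<phi> (Z t) - X t + e1 t))) / \<gamma>) (at t)"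
      unfolding L_def by (auto intro!: derivative_eq_intros)
    also have "((\<phi> (Z t) - 1) * (\<delta> * (\<psi> (X t) - Z t + e2 t))) / \<delta>
        + ((1 - \<psi> (X t)) * (\<gamma> * (\<phi> (Z t) - X t + e1 t))) / \<gamma>
        = - (\<phi> (Z t) - 1) * (Z t - 1) - (1 - \<psi> (X t)) * (X t - 1) + \<epsilon> t"
    proof -
      have "((\<phi> (Z t) - 1) * (\<delta> * (\<psi> (X t) - Z t + e2 t))) / \<delta> = (\<phi> (Z t) - 1) * (\<psi> (X t) - Z t + e2 t)"
        "((1 - \<psi> (X t)) * (\<gamma> * (\<phi> (Z t) - X t + e1 t))) / \<gamma> = (1 - \<psi> (X t)) * (\<phi> (Z t) - X t + e1 t)"
        using pos by simp_all
      then show ?thesis by (simp only:) (simp add: \<epsilon>_def algebra_simps)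
    qed
    finally show "(L has_real_derivative - (\<phi> (Z t) - 1) * (Z t - 1) - (1 - \<psi> (X t)) * (X t - 1) + \<epsilon> t) (at t)" .
    have "\<mu> * ((\<Phi> (Z t) - \<Phi> 1) / \<delta>) \<le> \<delta> * ((\<Phi> (Z t) - \<Phi> 1) / \<delta>)"
      using \<Phi>_nonneg[OF box(2)[OF t]] pos by (intro mult_right_mono) (auto simp: \<mu>_def)
    moreover have "\<mu> * ((\<Psi> (X t) - \<Psi> 1) / \<gamma>) \<le> \<gamma> * ((\<Psi> (X t) - \<Psi> 1) / \<gamma>)"
      using \<Psi>_nonneg[OF box(1)[OF t]] pos by (intro mult_right_mono) (auto simp: \<mu>_def)
    ultimately have "\<mu> * L t \<le> (\<Phi> (Z t) - \<Phi> 1) + (\<Psi> (X t) - \<Psi> 1)"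
      using pos by (simp add: L_def distrib_left)
    also have "\<dots> \<le> (\<phi> (Z t) - 1) * (Z t - 1) + (1 - \<psi> (X t)) * (X t - 1)"
      using t\<Phi>[OF box(2)[OF t] one] t\<Psi>[OF box(1)[OF t] one] by (simp add: algebra_simps)
    finally show "- (\<phi> (Z t) - 1) * (Z t - 1) - (1 - \<psi> (X t)) * (X t - 1) + \<epsilon> t \<le> - \<mu> * L t + \<epsilon> t"
      by (simp only: mult_minus_left)
    show "L t \<ge> 0" using \<Psi>_nonneg[OF box(1)[OF t]] pos by (intro order_trans[OF _ L_ge[OF t]]) auto
  next
    have "((\<lambda>t. (\<phi> (Z t) - 1) * e2 t) \<longlongrightarrow> 0) at_top"
    proof (rule Lim_null_comparison)
      show "eventually (\<lambda>t. norm ((\<phi> (Z t) - 1) * e2 t) \<le> (M1 + 1) * \<bar>e2 t\<bar>) at_top"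
        using eventually_ge_at_top[of t0]
      proof eventually_elim
        case (elim t)
        have "\<bar>\<phi> (Z t) - 1\<bar> \<le> M1 + 1" using M1[of "Z t"] box(2)[OF elim] by auto
        then show ?case by (auto simp: abs_mult intro: mult_right_mono)
      qed
      show "((\<lambda>t. (M1 + 1) * \<bar>e2 t\<bar>) \<longlongrightarrow> 0) at_top" using e(2) by (auto intro!: tendsto_eq_intros)
    qed
    moreover have "((\<lambda>t. (1 - \<psi> (X t)) * e1 t) \<longlongrightarrow> 0) at_top"
    proof (rule Lim_null_comparison)
      show "eventually (\<lambda>t. norm ((1 - \<psi> (X t)) * e1 t) \<le> (M2 + 1) * \<bar>e1 t\<bar>) at_top"
        using eventually_ge_at_top[of t0]
      proof eventually_elim
        case (elim t)
        have "\<bar>1 - \<psi> (X t)\<bar> \<le> M2 + 1" using M2[of "X t"] box(1)[OF elim] by auto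
        then show ?case by (auto simp: abs_mult intro: mult_right_mono)
      qed
      show "((\<lambda>t. (M2 + 1) * \<bar>e1 t\<bar>) \<longlongrightarrow> 0) at_top" using e(1) by (auto intro!: tendsto_eq_intros)
    qed
    ultimately show "(\<epsilon> \<longlongrightarrow> 0) at_top" unfolding \<epsilon>_def by (auto intro: tendsto_eq_intros)
  qed (use \<open>\<mu> > 0\<close> in auto)
  then have L_lim: "((\<lambda>t. \<gamma> * L t) \<longlongrightarrow> 0) at_top" by (auto intro: tendsto_eq_intros)
  have \<Psi>_lim: "((\<lambda>t. \<Psi> (X t) - \<Psi> 1) \<longlongrightarrow> 0) at_top"
  proof (rule Lim_null_comparison[where g = "\<lambda>t. \<gamma> * L t"])
    show "eventually (\<lambda>t. norm (\<Psi> (X t) - \<Psi> 1) \<le> \<gamma> * L t) at_top"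
      using eventually_ge_at_top[of t0]
    proof eventually_elim
      case (elim t)
      then show ?case using \<Psi>_nonneg[OF box(1)[OF elim]] L_ge[OF elim] pos
        by (simp add: field_simps)
    qed
  qed (rule L_lim)
  show ?thesis
  proof (rule order_tendstoI)
    fix y :: real assume "y < 1"
    (* the tangent of \<Psi> at a point m between y and 1 shows that \<Psi> X is not small when X \<le> y *)
    define m where "m = (max a y + 1) / 2"
    have m: "m \<in> {a<..<b}" "m < 1" "y < m" using ab \<open>y < 1\<close> by (auto simp: m_def)
    have "\<psi> m > 1" using mono(2)[of m 1] m fix1 ab by auto
    have "eventually (\<lambda>t. \<Psi> (X t) - \<Psi> 1 < (\<psi> m - 1) * (m - y)) at_top"
      using \<Psi>_lim m \<open>\<psi> m > 1\<close> by (intro order_tendstoD(2)) auto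
    with eventually_ge_at_top[of t0] show "eventually (\<lambda>t. y < X t) at_top"
    proof eventually_elim
      case (elim t)
      have "(\<psi> m - 1) * (m - X t) \<le> \<Psi> (X t) - \<Psi> m"
        using t\<Psi>[OF m(1) box(1)[OF elim(1)]] by (simp add: algebra_simps)
      also have "\<dots> \<le> \<Psi> (X t) - \<Psi> 1" using \<Psi>_nonneg[OF m(1)] by simp
      also have "\<dots> < (\<psi> m - 1) * (m - y)" by (rule elim)
      finally show ?case using \<open>\<psi> m > 1\<close> by simp
    qed
  next
    fix y :: real assume "1 < y"
    (* the mirror image: m lies between 1 and y *)
    define m where "m = (min b y + 1) / 2"
    have m: "m \<in> {a<..<b}" "m > 1" "y > m" using ab \<open>1 < y\<close> by (auto simp: m_def)
    have "\<psi> m < 1" using mono(2)[of 1 m] m fix1 ab by auto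
    have "eventually (\<lambda>t. \<Psi> (X t) - \<Psi> 1 < (1 - \<psi> m) * (y - m)) at_top"
      using \<Psi>_lim m \<open>\<psi> m < 1\<close> by (intro order_tendstoD(2)) auto
    with eventually_ge_at_top[of t0] show "eventually (\<lambda>t. X t < y) at_top"
    proof eventually_elim
      case (elim t)
      have "(1 - \<psi> m) * (X t - m) \<le> \<Psi> (X t) - \<Psi> m"
        using t\<Psi>[OF m(1) box(1)[OF elim(1)]] by (simp add: algebra_simps)
      also have "\<dots> \<le> \<Psi> (X t) - \<Psi> 1" using \<Psi>_nonneg[OF m(1)] by simp
      also have "\<dots> < (1 - \<psi> m) * (y - m)" by (rule elim)
      finally show ?case using \<open>\<psi> m < 1\<close> by simp
    qed
  qed
qed

section \<open>The loop with an oscillating coefficient\<close>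

lemma uniformly_continuous_diff_tendsto:
  fixes \<phi> Y Z :: "real \<Rightarrow> real"
  assumes "continuous_on {a..b} \<phi>" "eventually (\<lambda>t. Y t \<in> {a..b}) F" "eventually (\<lambda>t. Z t \<in> {a..b}) F"
    and "((\<lambda>t. Y t - Z t) \<longlongrightarrow> 0) F"
  shows "((\<lambda>t. \<phi> (Y t) - \<phi> (Z t)) \<longlongrightarrow> 0) F"
proof (rule tendstoI)
  fix e :: real assume "e > 0"
  have "uniformly_continuous_on {a..b} \<phi>"
    using assms(1) by (intro compact_uniformly_continuous) auto
  then obtain d where "d > 0"
    and d: "\<And>x y. x \<in> {a..b} \<Longrightarrow> y \<in> {a..b} \<Longrightarrow> dist y x < d \<Longrightarrow> dist (\<phi> y) (\<phi> x) < e"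
    using \<open>e > 0\<close> unfolding uniformly_continuous_on_def by metis
  have "eventually (\<lambda>t. dist (Y t - Z t) 0 < d) F" using assms(4) \<open>d > 0\<close> by (rule tendstoD)
  with assms(2,3) show "eventually (\<lambda>t. dist (\<phi> (Y t) - \<phi> (Z t)) 0 < e) F"
    by eventually_elim (use d in \<open>auto simp: dist_real_def\<close>)
qed

text \<open>The difficulty is that a bound on either variable seems to need one on the other. The product
\<open>S = Y X\<^sup>p\<close> breaks the circle: in \<open>S'\<close> the driving term \<open>Y\<^sup>\<kappa>\<close> of \<open>X\<close> enters with a positive sign and
may be dropped, which leaves a closed linear inequality for \<open>S\<close>. A lower bound for \<open>S\<close> then closes
the equation of \<open>X powr (1 + p \<kappa>)\<close>, and the remaining bounds follow in the order \<open>X\<close> from below,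
\<open>Y\<close> from above, \<open>X\<close> from above, \<open>Y\<close> from below.\<close>

lemma power_loop_permanence:
  fixes X Y H :: "real \<Rightarrow> real"
  assumes pos: "\<gamma> > 0" "\<delta> > 0" "p > 0" "\<kappa> > 0"
    and X: "\<And>t. t \<ge> t0 \<Longrightarrow> X t > 0" and Y: "\<And>t. t \<ge> t0 \<Longrightarrow> Y t > 0"
    and dX: "\<And>t. t \<ge> t0 \<Longrightarrow> (X has_real_derivative \<gamma> * (Y t powr \<kappa> - X t)) (at t)"
    and dY: "\<And>t. t \<ge> t0 \<Longrightarrow> (Y has_real_derivative \<delta> * (H t * X t powr - p - Y t)) (at t)"
    and H: "hl > 0" "\<And>t. t \<ge> t0 \<Longrightarrow> hl \<le> H t" "\<And>t. t \<ge> t0 \<Longrightarrow> H t \<le> hu"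
  obtains m M where "m > 0" "\<And>t. t \<ge> t0 \<Longrightarrow> X t \<in> {m..M}" "\<And>t. t \<ge> t0 \<Longrightarrow> Y t \<in> {m..M}"
proof -
  define S where "S t = Y t * X t powr p" for t
  define \<mu> where "\<mu> = \<delta> + p * \<gamma>"
  define s0 where "s0 = min (S t0) (\<delta> * hl / \<mu>)"
  have "\<mu> > 0" using pos by (simp add: \<mu>_def add_pos_pos)
  have hu: "hu > 0" using H(1) H(2)[of t0] H(3)[of t0] by simp
  have "s0 > 0" using X[of t0] Y[of t0] pos H(1) \<open>\<mu> > 0\<close> by (simp add: s0_def S_def)
  have S_lower: "S t \<ge> s0" if "t \<ge> t0" for t
    unfolding s0_def
  proof (rule comparison_min[where q = S and \<mu> = \<mu>])
    fix s assume s: "s \<ge> t0"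
    have pw: "X s powr (p - 1) * X s = X s powr p"
      using X[OF s] by (simp add: powr_diff)
    show "(S has_real_derivative \<delta> * (H s * X s powr - p - Y s) * X s powr p
        + Y s * (p * X s powr (p - 1) * (\<gamma> * (Y s powr \<kappa> - X s)))) (at s)"
      unfolding S_def using X[OF s]
      by (auto intro!: derivative_eq_intros dX[OF s] dY[OF s])
    have "\<delta> * (H s * X s powr - p - Y s) * X s powr p
        + Y s * (p * X s powr (p - 1) * (\<gamma> * (Y s powr \<kappa> - X s)))
      = \<delta> * H s * (X s powr - p * X s powr p) - \<delta> * S s
        + p * \<gamma> * Y s * X s powr (p - 1) * Y s powr \<kappa> - p * \<gamma> * Y s * (X s powr (p - 1) * X s)"
      by (simp add: S_def algebra_simps)
    also have "\<dots> = \<delta> * H s + p * \<gamma> * Y s * X s powr (p - 1) * Y s powr \<kappa> - \<mu> * S s"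
      using X[OF s] unfolding pw by (simp add: \<mu>_def S_def algebra_simps flip: powr_add)
    also have "\<dots> \<ge> \<delta> * hl + 0 - \<mu> * S s"
      using pos Y[OF s] H(2)[OF s] \<open>\<mu> > 0\<close> by (intro diff_mono add_mono mult_left_mono mult_nonneg_nonneg) auto
    also have "\<delta> * hl + 0 - \<mu> * S s = \<mu> * (\<delta> * hl / \<mu> - S s)"
      using \<open>\<mu> > 0\<close> by (simp add: field_simps)
    finally show "\<mu> * (\<delta> * hl / \<mu> - S s) \<le> \<delta> * (H s * X s powr - p - Y s) * X s powr p
        + Y s * (p * X s powr (p - 1) * (\<gamma> * (Y s powr \<kappa> - X s)))" .
  qed (use that \<open>\<mu> > 0\<close> in auto)
  define \<theta> where "\<theta> = 1 + p * \<kappa>"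
  have "\<theta> > 0" using pos by (simp add: \<theta>_def add_pos_pos)
  define r0 where "r0 = min (X t0 powr \<theta>) (s0 powr \<kappa>)"
  have "r0 > 0" using X[of t0] \<open>s0 > 0\<close> by (simp add: r0_def)
  have R_lower: "X t powr \<theta> \<ge> r0" if "t \<ge> t0" for t
    unfolding r0_def
  proof (rule comparison_min[where q = "\<lambda>t. X t powr \<theta>" and \<mu> = "\<theta> * \<gamma>"])
    fix s assume s: "s \<ge> t0"
    show "((\<lambda>t. X t powr \<theta>) has_real_derivative \<theta> * X s powr (\<theta> - 1) * (\<gamma> * (Y s powr \<kappa> - X s))) (at s)"
      using X[OF s] by (auto intro!: derivative_eq_intros dX[OF s])
    have pw: "X s powr (\<theta> - 1) * X s = X s powr \<theta>"
      using X[OF s] by (simp add: powr_diff)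
    have "X s powr (\<theta> - 1) * Y s powr \<kappa> = S s powr \<kappa>"
      using X[OF s] Y[OF s] by (simp add: S_def \<theta>_def powr_mult powr_powr)
    then have "\<theta> * X s powr (\<theta> - 1) * (\<gamma> * (Y s powr \<kappa> - X s)) = \<theta> * \<gamma> * (S s powr \<kappa> - X s powr \<theta>)"
      using pw by (simp add: algebra_simps)
    moreover have "S s powr \<kappa> \<ge> s0 powr \<kappa>"
      using S_lower[OF s] \<open>s0 > 0\<close> pos by (intro powr_mono2) auto
    ultimately show "\<theta> * \<gamma> * (s0 powr \<kappa> - X s powr \<theta>) \<le> \<theta> * X s powr (\<theta> - 1) * (\<gamma> * (Y s powr \<kappa> - X s))"
      using pos \<open>\<theta> > 0\<close> by simp
  qed (use that pos \<open>\<theta> > 0\<close> in auto)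
  define xl where "xl = r0 powr (1 / \<theta>)"
  have "xl > 0" using \<open>r0 > 0\<close> by (simp add: xl_def)
  have xl: "X t \<ge> xl" if "t \<ge> t0" for t
  proof -
    have "xl \<le> (X t powr \<theta>) powr (1 / \<theta>)"
      unfolding xl_def using R_lower[OF that] \<open>r0 > 0\<close> \<open>\<theta> > 0\<close> by (intro powr_mono2) auto
    then show ?thesis using X[OF that] \<open>\<theta> > 0\<close> by (simp add: powr_powr)
  qed
  define yu where "yu = max (Y t0) (hu * xl powr - p)"
  have yu: "Y t \<le> yu" if "t \<ge> t0" for t
    unfolding yu_def
  proof (rule comparison_max[where q = Y and \<mu> = \<delta>, OF dY])
    fix s assume s: "s \<ge> t0"
    have "H s * X s powr - p \<le> hu * xl powr - p"
      using H(2,3)[OF s] H(1) hu xl[OF s] \<open>xl > 0\<close> pos by (intro mult_mono powr_mono2') auto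
    then show "\<delta> * (H s * X s powr - p - Y s) \<le> \<delta> * (hu * xl powr - p - Y s)"
      using pos by simp
  qed (use that pos in auto)
  define xu where "xu = max (X t0) (yu powr \<kappa>)"
  have xu: "X t \<le> xu" if "t \<ge> t0" for t
    unfolding xu_def
  proof (rule comparison_max[where q = X and \<mu> = \<gamma>, OF dX])
    fix s assume s: "s \<ge> t0"
    have "Y s powr \<kappa> \<le> yu powr \<kappa>"
      using Y[OF s] yu[OF s] pos by (intro powr_mono2) auto
    then show "\<gamma> * (Y s powr \<kappa> - X s) \<le> \<gamma> * (yu powr \<kappa> - X s)"
      using pos by simp
  qed (use that pos in auto)
  define yl where "yl = min (Y t0) (hl * xu powr - p)"
  have "xu > 0" using xu[of t0] X[of t0] by simp
  then have "yl > 0" using Y[of t0] H(1) by (simp add: yl_def)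
  have yl: "Y t \<ge> yl" if "t \<ge> t0" for t
    unfolding yl_def
  proof (rule comparison_min[where q = Y and \<mu> = \<delta>, OF dY])
    fix s assume s: "s \<ge> t0"
    have "hl * xu powr - p \<le> H s * X s powr - p"
      using H(2)[OF s] H(1) xu[OF s] X[OF s] pos by (intro mult_mono powr_mono2') auto
    then show "\<delta> * (hl * xu powr - p - Y s) \<le> \<delta> * (H s * X s powr - p - Y s)"
      using pos by simp
  qed (use that pos in auto)
  show ?thesis
  proof (rule that)
    show "min xl yl > 0" using \<open>xl > 0\<close> \<open>yl > 0\<close> by simp
    show "X t \<in> {min xl yl..max xu yu}" "Y t \<in> {min xl yl..max xu yu}" if "t \<ge> t0" for t
      using xl xu yl yu that by (auto simp: min_le_iff_disj le_max_iff_disj)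
  qed
qed

text \<open>The hypothesis on \<open>Q\<close> expresses that \<open>H\<close> averages to \<open>1\<close>. Since \<open>X\<close> has a bounded derivative,
\<open>Z = Y - \<delta> Q X\<^sup>-\<^sup>p\<close> satisfies the equation of \<open>Y\<close> with \<open>H\<close> replaced by \<open>1\<close>, up to an error that is
\<open>Q\<close> times a bounded quantity.\<close>

lemma oscillating_power_loop_tendsto:
  fixes X Y H Q :: "real \<Rightarrow> real"
  assumes pos: "\<gamma> > 0" "\<delta> > 0" "p > 0" "\<kappa> > 0"
    and X: "\<And>t. t \<ge> t0 \<Longrightarrow> X t > 0" and Y: "\<And>t. t \<ge> t0 \<Longrightarrow> Y t > 0"
    and dX: "\<And>t. t \<ge> t0 \<Longrightarrow> (X has_real_derivative \<gamma> * (Y t powr \<kappa> - X t)) (at t)"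
    and dY: "\<And>t. t \<ge> t0 \<Longrightarrow> (Y has_real_derivative \<delta> * (H t * X t powr - p - Y t)) (at t)"
    and H: "hl > 0" "\<And>t. t \<ge> t0 \<Longrightarrow> hl \<le> H t" "\<And>t. t \<ge> t0 \<Longrightarrow> H t \<le> hu"
    and dQ: "\<And>t. t \<ge> t0 \<Longrightarrow> (Q has_real_derivative H t - 1 - Q t) (at t)"
    and Q: "(Q \<longlongrightarrow> 0) at_top"
  shows "(X \<longlongrightarrow> 1) at_top"
proof -
  obtain m M where "m > 0" and mM: "\<And>t. t \<ge> t0 \<Longrightarrow> X t \<in> {m..M}" "\<And>t. t \<ge> t0 \<Longrightarrow> Y t \<in> {m..M}"
    using power_loop_permanence[OF pos X Y dX dY H] by blast
  define a where "a = min m 1 / 2"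
  define b where "b = max M 1 + 1"
  have ab: "0 < a" "a < 1" "1 < b" "a < m" "M < b" using \<open>m > 0\<close> by (auto simp: a_def b_def)
  define Z where "Z t = Y t - \<delta> * Q t * X t powr - p" for t
  (* \<delta> * Q * W is the difference between Z' and the right-hand side with H replaced by 1 *)
  define W where "W x y = (1 - \<delta>) * x powr - p + p * x powr (- p - 1) * (\<gamma> * (y powr \<kappa> - x))" for x y
  define e2 where "e2 t = Q t * W (X t) (Y t)" for t
  have "compact ((\<lambda>(x, y). W x y) ` ({m..M} \<times> {m..M}))"
    unfolding W_def case_prod_beta using \<open>m > 0\<close>
    by (intro compact_continuous_image compact_Times compact_Icc continuous_intros) auto
  then obtain B where B: "\<And>x y. x \<in> {m..M} \<Longrightarrow> y \<in> {m..M} \<Longrightarrow> \<bar>W x y\<bar> \<le> B"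
    by (fastforce dest!: compact_imp_bounded simp: bounded_iff)
  have e2: "(e2 \<longlongrightarrow> 0) at_top"
  proof (rule Lim_null_comparison)
    show "eventually (\<lambda>t. norm (e2 t) \<le> \<bar>Q t\<bar> * B) at_top"
      using eventually_ge_at_top[of t0]
      by eventually_elim (use B mM in \<open>auto simp: e2_def abs_mult intro!: mult_left_mono\<close>)
    show "((\<lambda>t. \<bar>Q t\<bar> * B) \<longlongrightarrow> 0) at_top" using Q by (auto intro!: tendsto_eq_intros)
  qed
  have YZ: "((\<lambda>t. Y t - Z t) \<longlongrightarrow> 0) at_top"
  proof (rule Lim_null_comparison)
    show "eventually (\<lambda>t. norm (Y t - Z t) \<le> \<delta> * \<bar>Q t\<bar> * m powr - p) at_top"
      using eventually_ge_at_top[of t0]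
    proof eventually_elim
      case (elim t)
      have "X t powr - p \<le> m powr - p" using mM(1)[OF elim] \<open>m > 0\<close> pos by (intro powr_mono2') auto
      then show ?case using pos by (auto simp: Z_def abs_mult intro!: mult_left_mono)
    qed
    show "((\<lambda>t. \<delta> * \<bar>Q t\<bar> * m powr - p) \<longlongrightarrow> 0) at_top" using Q by (auto intro!: tendsto_eq_intros)
  qed
  have "eventually (\<lambda>t. dist (Y t - Z t) 0 < min (m - a) (b - M)) at_top"
    using YZ by (rule tendstoD) (use ab in auto)
  then obtain t1 where t1: "\<And>t. t \<ge> t1 \<Longrightarrow> \<bar>Y t - Z t\<bar> < min (m - a) (b - M)"
    by (auto simp: eventually_at_top_linorder)
  define t2 where "t2 = max t0 t1"
  have boxZ: "Z t \<in> {a<..<b}" if "t \<ge> t2" for t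
    using t1[of t] mM(2)[of t] that ab by (auto simp: t2_def)
  have cont: "continuous_on {a..b} (\<lambda>y. y powr \<kappa>)" "continuous_on {a..b} (\<lambda>x. x powr - p)"
    using ab by (auto intro!: continuous_intros)
  have e1: "((\<lambda>t. Y t powr \<kappa> - Z t powr \<kappa>) \<longlongrightarrow> 0) at_top"
  proof (rule uniformly_continuous_diff_tendsto[OF cont(1) _ _ YZ])
    show "\<forall>\<^sub>F t in at_top. Y t \<in> {a..b}"
      using eventually_ge_at_top[of t0] by eventually_elim (use mM ab in fastforce)
    show "\<forall>\<^sub>F t in at_top. Z t \<in> {a..b}"
      using eventually_ge_at_top[of t2] by eventually_elim (use boxZ in fastforce)
  qed
  show ?thesis
  proof (rule feedback_loop_tendsto[OF ab(2,3) pos(1,2) cont, of t2 X Z])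
    show "mono_on {a..b} (\<lambda>y. y powr \<kappa>)"
      using ab pos by (auto intro!: mono_onI powr_mono2)
    show "y powr - p < x powr - p" if "a \<le> x" "x < y" "y \<le> b" for x y
      using that ab pos by (intro powr_less_mono2_neg) auto
    show "X t \<in> {a<..<b}" if "t \<ge> t2" for t
      using mM(1)[of t] that ab by (auto simp: t2_def)
    show "Z t \<in> {a<..<b}" if "t \<ge> t2" for t by (rule boxZ[OF that])
    show "(X has_real_derivative \<gamma> * (Z t powr \<kappa> - X t + (Y t powr \<kappa> - Z t powr \<kappa>))) (at t)"
      if "t \<ge> t2" for t
      using dX[of t] that by (simp add: t2_def algebra_simps)
    show "(Z has_real_derivative \<delta> * (X t powr - p - Z t + e2 t)) (at t)" if "t \<ge> t2" for t
    proof -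
      have t: "t \<ge> t0" using that by (simp add: t2_def)
      have "(Z has_real_derivative \<delta> * (H t * X t powr - p - Y t)
          - (\<delta> * (H t - 1 - Q t) * X t powr - p
             + \<delta> * Q t * (- p * X t powr (- p - 1) * (\<gamma> * (Y t powr \<kappa> - X t))))) (at t)"
        unfolding Z_def using X[OF t]
        by (auto intro!: derivative_eq_intros dX[OF t] dY[OF t] dQ[OF t])
      also have "\<delta> * (H t * X t powr - p - Y t)
          - (\<delta> * (H t - 1 - Q t) * X t powr - p
             + \<delta> * Q t * (- p * X t powr (- p - 1) * (\<gamma> * (Y t powr \<kappa> - X t))))
          = \<delta> * (X t powr - p - Z t + e2 t)"
        by (simp add: e2_def W_def Z_def algebra_simps)
      finally show ?thesis .
    qed
  qed (use e1 e2 in auto)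
qed

section \<open>Means of periodic functions on a half-line\<close>

lemma periodic_value_in_period:
  fixes F :: "real \<Rightarrow> 'a"
  assumes per: "\<And>r. r \<ge> 0 \<Longrightarrow> F (r + T) = F r" and "T > 0" "r \<ge> 0"
  obtains s where "s \<in> {0..T}" "F r = F s"
proof -
  have mult: "F (s + real N * T) = F s" if "s \<ge> 0" for s N
  proof (induction N)
    case (Suc N)
    have "F (s + real (Suc N) * T) = F ((s + real N * T) + T)" by (simp add: algebra_simps)
    also have "\<dots> = F (s + real N * T)" using that \<open>T > 0\<close> by (intro per) auto
    finally show ?case using Suc by simp
  qed simp
  define N where "N = nat \<lfloor>r / T\<rfloor>"
  have "real N \<le> r / T" "r / T \<le> real N + 1"
    using \<open>T > 0\<close> \<open>r \<ge> 0\<close> of_int_floor_le[of "r / T"] real_of_int_floor_add_one_gt[of "r / T"]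
    by (auto simp: N_def)
  then have "r - real N * T \<in> {0..T}" using \<open>T > 0\<close> by (auto simp: field_simps)
  moreover have "F r = F (r - real N * T)" using mult[of "r - real N * T" N] calculation by simp
  ultimately show ?thesis by (rule that[rotated, rotated]) 
qed

lemma periodic_continuous_bounds:
  fixes h :: "real \<Rightarrow> real"
  assumes cont: "continuous_on {0..} h" and per: "\<And>r. r \<ge> 0 \<Longrightarrow> h (r + T) = h r" and "T > 0"
    and pos: "\<And>r. r \<ge> 0 \<Longrightarrow> h r > 0"
  shows "\<exists>hl hu. hl > 0 \<and> (\<forall>r\<ge>0. hl \<le> h r \<and> h r \<le> hu)"
proof -
  have c: "continuous_on {0..T} h" by (rule continuous_on_subset[OF cont]) auto
  obtain s1 where s1: "s1 \<in> {0..T}" "\<And>s. s \<in> {0..T} \<Longrightarrow> h s1 \<le> h s"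
    using continuous_attains_inf[OF _ _ c] \<open>T > 0\<close> by auto
  obtain s2 where s2: "s2 \<in> {0..T}" "\<And>s. s \<in> {0..T} \<Longrightarrow> h s \<le> h s2"
    using continuous_attains_sup[OF _ _ c] \<open>T > 0\<close> by auto
  show ?thesis
  proof (intro exI conjI allI impI)
    show "h s1 > 0" using s1 by (intro pos) auto
    show "h s1 \<le> h r" "h r \<le> h s2" if "r \<ge> 0" for r
      using periodic_value_in_period[where F = h, OF per \<open>T > 0\<close> that] s1 s2 by metis+
  qed
qed

text \<open>Taking the mean as a limit, and not over one period, makes it a function of \<open>h\<close> alone, and
visibly one of its values on the half-line.\<close>

definition half_line_mean :: "(real \<Rightarrow> real) \<Rightarrow> real" where
  "half_line_mean h = Lim at_top (\<lambda>r. integral {0..r} h / r)"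

lemma half_line_mean_cong:
  assumes "\<And>r. r \<ge> 0 \<Longrightarrow> h1 r = h2 r"
  shows "half_line_mean h1 = half_line_mean h2"
proof -
  have "integral {0..r} h1 = integral {0..r} h2" for r
    by (rule integral_cong) (use assms in auto)
  then show ?thesis by (simp add: half_line_mean_def)
qed

text \<open>With \<open>m\<close> the mean over one period, \<open>\<integral>\<^sub>0\<^sup>r h - r m\<close> is again periodic and continuous, hence bounded;
dividing by \<open>r\<close> identifies \<open>m\<close> as the limit.\<close>

lemma periodic_integral_near_linear:
  fixes h :: "real \<Rightarrow> real"
  assumes cont: "continuous_on {0..} h" and per: "\<And>r. r \<ge> 0 \<Longrightarrow> h (r + T) = h r" and T: "T > 0"
    and pos: "\<And>r. r \<ge> 0 \<Longrightarrow> h r > 0"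
  shows "half_line_mean h > 0"
    and "\<exists>B. \<forall>r\<ge>0. \<bar>integral {0..r} h - r * half_line_mean h\<bar> \<le> B"
proof -
  have int: "h integrable_on {a..b}" if "a \<ge> 0" for a b
    using that by (intro integrable_continuous_real continuous_on_subset[OF cont]) auto
  define m where "m = integral {0..T} h / T"
  define P where "P r = integral {0..r} h - r * m" for r
  have P_per: "P (r + T) = P r" if "r \<ge> 0" for r
  proof -
    have "integral {0..r + T} h = integral {0..T} h + integral {T..r + T} h"
      using Henstock_Kurzweil_Integration.integral_combine[of 0 T "r + T" h] int that T by simp
    also have "integral {T..r + T} h = integral {T - T..r + T - T} (\<lambda>s. h (s + T))"
      by (rule integral_shift_real_ivl[symmetric])
    also have "\<dots> = integral {0..r} h"
      using that by (auto intro!: integral_cong per)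
    finally show ?thesis using T by (simp add: P_def m_def field_simps)
  qed
  have "continuous_on {0..T} P"
    unfolding P_def by (intro continuous_intros indefinite_integral_continuous_1 int) auto
  then have "bounded (P ` {0..T})"
    by (intro compact_imp_bounded compact_continuous_image) auto
  then obtain B where B: "\<And>s. s \<in> {0..T} \<Longrightarrow> \<bar>P s\<bar> \<le> B" by (force simp: bounded_iff)
  have PB: "\<bar>P r\<bar> \<le> B" if "r \<ge> 0" for r
    using periodic_value_in_period[where F = P, OF P_per T that] B by metis
  have "((\<lambda>r. integral {0..r} h / r) \<longlongrightarrow> m) at_top"
  proof (rule Lim_transform[OF tendsto_const])
    show "((\<lambda>r. integral {0..r} h / r - m) \<longlongrightarrow> 0) at_top"
    proof (rule Lim_null_comparison)
      show "eventually (\<lambda>r. norm (integral {0..r} h / r - m) \<le> B / r) at_top"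
        using eventually_gt_at_top[of 0]
      proof eventually_elim
        case (elim r)
        have "integral {0..r} h / r - m = P r / r" using elim by (simp add: P_def field_simps)
        then show ?case using PB[of r] elim by (simp add: divide_right_mono)
      qed
      show "((\<lambda>r. B / r) \<longlongrightarrow> 0) at_top"
        by (rule tendsto_divide_0[OF tendsto_const]) (rule filterlim_at_top_imp_at_infinity[OF filterlim_ident])
    qed
  qed
  then have mean: "half_line_mean h = m"
    unfolding half_line_mean_def by (intro tendsto_Lim) auto
  obtain hl hu where hl: "hl > 0" "\<forall>r\<ge>0. hl \<le> h r \<and> h r \<le> hu"
    using periodic_continuous_bounds[OF cont per T pos] by blast
  have "integral {0..T} (\<lambda>_. hl) \<le> integral {0..T} h"
    by (intro integral_le int) (use hl in auto)
  moreover have "integral {0..T} (\<lambda>_. hl) = T * hl" "T * hl > 0" using T hl by auto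
  ultimately have "integral {0..T} h > 0" by linarith
  then show "half_line_mean h > 0" using T by (simp add: mean m_def)
  show "\<exists>B. \<forall>r\<ge>0. \<bar>integral {0..r} h - r * half_line_mean h\<bar> \<le> B"
    using PB unfolding P_def mean by blast
qed

section \<open>The time factor\<close>

lemma powr_lipschitz:
  fixes x y :: real
  assumes "0 < \<beta>" "\<beta> \<le> 1" "l > 0" "x \<ge> l" "y \<ge> l"
  shows "\<bar>x powr \<beta> - y powr \<beta>\<bar> \<le> \<beta> * l powr (\<beta> - 1) * \<bar>x - y\<bar>"
proof -
  have "norm (x powr \<beta> - y powr \<beta>) \<le> \<beta> * l powr (\<beta> - 1) * norm (x - y)"
  proof (rule field_differentiable_bound)
    fix z assume "z \<in> {l..}"
    then show "((\<lambda>x. x powr \<beta>) has_field_derivative \<beta> * z powr (\<beta> - 1)) (at z within {l..})"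
      using assms by (auto intro!: derivative_eq_intros)
    show "norm (\<beta> * z powr (\<beta> - 1)) \<le> \<beta> * l powr (\<beta> - 1)"
      using assms \<open>z \<in> {l..}\<close> powr_mono2'[of "\<beta> - 1" l z] by (simp add: abs_mult)
  qed (use assms in auto)
  then show ?thesis by simp
qed

lemma time_factor_asymptotics:
  assumes "k \<ge> 1" "\<alpha> > 0" and cont: "continuous_on {..0} g" and pos: "\<And>t. t \<le> 0 \<Longrightarrow> g t > 0"
    and per: "period_left g T"
  shows "(\<lambda>t. time_factor k \<alpha> g t
           - ((real k * \<alpha> + 1) * half_line_mean (\<lambda>s. g (- s))) powr (1 / (real k * \<alpha> + 1))
             * (- t) powr (1 / (real k * \<alpha> + 1)))
       \<in> O[at_bot](\<lambda>t. (- t) powr (1 / (real k * \<alpha> + 1) - 1))"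
proof -
  define h where "h s = g (- s)" for s
  define \<beta> where "\<beta> = 1 / (real k * \<alpha> + 1)"
  define m where "m = half_line_mean h"
  define A where "A = (real k * \<alpha> + 1) powr \<beta>"
  have \<beta>: "0 < \<beta>" "\<beta> \<le> 1" using assms(1,2) by (auto simp: \<beta>_def divide_simps add_pos_pos)
  have hcont: "continuous_on {0..} h"
    unfolding h_def by (rule continuous_on_compose2[OF cont]) (auto intro!: continuous_intros)
  have hper: "h (r + T) = h r" if "r \<ge> 0" for r
    using per that unfolding period_left_def h_def by (metis minus_add_distrib neg_le_0_iff_le uminus_add_conv_diff add.commute)
  have "T > 0" using per by (simp add: period_left_def)
  have hpos: "h r > 0" if "r \<ge> 0" for r using that pos by (simp add: h_def)
  have "m > 0" unfolding m_def by (rule periodic_integral_near_linear(1)[OF hcont hper \<open>T > 0\<close> hpos])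
  obtain B where B: "\<And>r. r \<ge> 0 \<Longrightarrow> \<bar>integral {0..r} h - r * m\<bar> \<le> B"
    unfolding m_def using periodic_integral_near_linear(2)[OF hcont hper \<open>T > 0\<close> hpos] by blast
  have "B \<ge> 0" using B[of 0] by simp
  have "(\<lambda>t. time_factor k \<alpha> g t - ((real k * \<alpha> + 1) * m) powr \<beta> * (- t) powr \<beta>)
    \<in> O[at_bot](\<lambda>t. (- t) powr (\<beta> - 1))"
  proof (rule bigoI[where c = "A * (\<beta> * (m / 2) powr (\<beta> - 1) * (B + 1))"])
    show "\<forall>\<^sub>F t in at_bot. norm (time_factor k \<alpha> g t - ((real k * \<alpha> + 1) * m) powr \<beta> * (- t) powr \<beta>)
      \<le> A * (\<beta> * (m / 2) powr (\<beta> - 1) * (B + 1)) * norm ((- t) powr (\<beta> - 1))"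
      (* for - t beyond 2 B / m both bases are at least m (- t) / 2, where the power function is Lipschitz *)
      using eventually_le_at_bot[of "- (2 * B / m)"] eventually_le_at_bot[of "-1"]
    proof eventually_elim
      case (elim t)
      define s where "s = - t"
      have s: "s \<ge> 1" "m * s / 2 \<ge> B" using elim \<open>m > 0\<close> by (auto simp: s_def field_simps)
      define G where "G = integral {0..s} h"
      have "integral {t..0} g = G"
        using Henstock_Kurzweil_Integration.integral_reflect_real[where a = t and b = 0 and f = g] by (simp add: G_def s_def h_def[abs_def])
      then have "time_factor k \<alpha> g t = A * (1 + G) powr \<beta>"
        by (simp add: time_factor_def A_def \<beta>_def)
      moreover have "((real k * \<alpha> + 1) * m) powr \<beta> * (- t) powr \<beta> = A * (m * s) powr \<beta>"
        using \<open>m > 0\<close> assms(1,2) s by (simp add: A_def powr_mult flip: s_def)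
      ultimately have "time_factor k \<alpha> g t - ((real k * \<alpha> + 1) * m) powr \<beta> * (- t) powr \<beta>
          = A * ((1 + G) powr \<beta> - (m * s) powr \<beta>)"
        by (simp add: right_diff_distrib)
      then have "norm (time_factor k \<alpha> g t - ((real k * \<alpha> + 1) * m) powr \<beta> * (- t) powr \<beta>)
          = A * \<bar>(1 + G) powr \<beta> - (m * s) powr \<beta>\<bar>"
        by (simp add: A_def abs_mult)
      also have "\<dots> \<le> A * (\<beta> * (m * s / 2) powr (\<beta> - 1) * \<bar>1 + G - m * s\<bar>)"
      proof (intro mult_left_mono powr_lipschitz \<beta>)
        show "0 < m * s / 2" "m * s / 2 \<le> m * s" using \<open>m > 0\<close> s by auto
        show "m * s / 2 \<le> 1 + G" using B[of s] s by (auto simp: G_def algebra_simps)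
      qed (auto simp: A_def)
      also have "\<dots> \<le> A * (\<beta> * (m * s / 2) powr (\<beta> - 1) * (B + 1))"
        using B[of s] s \<beta> by (intro mult_left_mono) (auto simp: G_def A_def algebra_simps)
      also have "(m * s / 2) powr (\<beta> - 1) = (m / 2) powr (\<beta> - 1) * s powr (\<beta> - 1)"
        using powr_mult[of "m / 2" s "\<beta> - 1"] \<open>m > 0\<close> s by simp
      finally show ?case by (simp add: s_def mult_ac)
    qed
  qed
  then show ?thesis by (simp add: m_def h_def[abs_def] \<beta>_def)
qed

section \<open>The radial factor\<close>

text \<open>The constant is determined by requiring that \<open>C r powr \<gamma>\<close> balances the equation with
\<open>f powr (1 / \<alpha>)\<close> replaced by its mean \<open>F\<close>: this reads
\<open>n / (n choose k) * F = (n - \<gamma> / \<alpha>) * \<gamma> ^ k * C powr (k + 1 / \<alpha>)\<close>.\<close>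

lemma radial_factor_asymptotics:
  fixes n k :: nat and \<alpha> :: real and f v :: "real \<Rightarrow> real"
  assumes kn: "1 \<le> k" "k \<le> n" and \<alpha>: "\<alpha> > 0" "\<alpha> > (2 * real k - real n) / (real k * real n)"
    and cont: "continuous_on {0..} f" and pos: "\<And>r. r \<ge> 0 \<Longrightarrow> f r > 0"
    and per: "period_right f T" and v: "radial_factor n k \<alpha> f v"
  defines "\<gamma> \<equiv> 2 * real k * \<alpha> / (real k * \<alpha> + 1)"
  defines "C \<equiv> (real n / real (n choose k) * half_line_mean (\<lambda>s. f s powr (1 / \<alpha>))
                / ((real n - \<gamma> / \<alpha>) * \<gamma> ^ k)) powr (1 / (real k + 1 / \<alpha>))"
  shows "(\<lambda>r. v r - C * r powr \<gamma>) \<in> o[at_top](\<lambda>r. r powr \<gamma>)"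
proof -
  define p where "p = 1 / \<alpha>"
  define h where "h s = f s powr p" for s
  define F where "F = half_line_mean h"
  define c where "c = real n / real (n choose k)"
  define \<delta> where "\<delta> = real n - p * \<gamma>"
  define D where "D = (C * \<gamma>) ^ k"
  have "p > 0" using \<alpha> by (simp add: p_def)
  have k0: "real k > 0" and n0: "real n > 0" using kn by auto
  have "c > 0" using kn by (simp add: c_def)
  have ka: "real k * \<alpha> + 1 > 0" using k0 \<alpha> by (simp add: add_pos_pos)
  have "\<gamma> > 0" using k0 \<alpha> ka by (simp add: \<gamma>_def)
  (* homogeneity: the two sides of the equation scale with the same power of r *)
  have pk: "p * \<gamma> + real k * \<gamma> = 2 * real k"
  proof -
    have "p * \<gamma> + real k * \<gamma> = \<gamma> * (real k * \<alpha> + 1) / \<alpha>" using \<alpha> by (simp add: p_def field_simps)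
    also have "\<dots> = 2 * real k" using ka \<alpha> by (simp add: \<gamma>_def)
    finally show ?thesis .
  qed
  have "\<delta> > 0"
  proof -
    have "2 * real k - real n < \<alpha> * (real k * real n)"
      using \<alpha>(2) k0 n0 by (simp add: pos_divide_less_eq)
    then have "2 * real k < real n * (real k * \<alpha> + 1)" by (simp add: algebra_simps)
    then have "2 * real k / (real k * \<alpha> + 1) < real n" using ka by (simp add: pos_divide_less_eq)
    moreover have "p * \<gamma> = 2 * real k / (real k * \<alpha> + 1)" using \<alpha> by (simp add: p_def \<gamma>_def)
    ultimately show ?thesis by (simp add: \<delta>_def)
  qed
  have "T > 0" using per by (simp add: period_right_def)
  have hcont: "continuous_on {0..} h"
    unfolding h_def using pos by (intro continuous_intros cont) (auto simp: less_imp_neq[symmetric])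
  have hper: "h (r + T) = h r" if "r \<ge> 0" for r
    using per that by (simp add: period_right_def h_def)
  have hpos: "h r > 0" if "r \<ge> 0" for r using pos[OF that] by (simp add: h_def)
  have "F > 0" unfolding F_def by (rule periodic_integral_near_linear(1)[OF hcont hper \<open>T > 0\<close> hpos])
  obtain B where B: "\<And>r. r \<ge> 0 \<Longrightarrow> \<bar>integral {0..r} h - r * F\<bar> \<le> B"
    unfolding F_def using periodic_integral_near_linear(2)[OF hcont hper \<open>T > 0\<close> hpos] by blast
  obtain hl hu where hlu: "hl > 0" "\<forall>r\<ge>0. hl \<le> h r \<and> h r \<le> hu"
    using periodic_continuous_bounds[OF hcont hper \<open>T > 0\<close> hpos] by blast
  define K where "K = c * F / (\<delta> * \<gamma> ^ k)"
  have C_eq: "C = K powr (1 / (real k + p))"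
    by (simp add: C_def K_def c_def F_def h_def[abs_def] p_def \<delta>_def)
  have "K > 0" using \<open>c > 0\<close> \<open>F > 0\<close> \<open>\<delta> > 0\<close> \<open>\<gamma> > 0\<close> by (simp add: K_def)
  then have "C > 0" and "C powr (real k + p) = K"
    unfolding C_eq using k0 \<open>p > 0\<close> by (simp_all add: powr_powr)
  then have "c * F = \<delta> * \<gamma> ^ k * C powr (real k + p)"
    using \<open>\<delta> > 0\<close> \<open>\<gamma> > 0\<close> by (simp add: K_def field_simps)
  then have cF: "c * F = \<delta> * D * C powr p"
    using \<open>C > 0\<close> by (simp add: D_def powr_add powr_realpow power_mult_distrib)
  have "D > 0" using \<open>C > 0\<close> \<open>\<gamma> > 0\<close> by (simp add: D_def)
  have D_root: "D powr (1 / real k) = C * \<gamma>"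
    using \<open>C > 0\<close> \<open>\<gamma> > 0\<close> kn k0 by (simp add: D_def powr_powr flip: powr_realpow)
  have vpos: "v r > 0" if "r \<ge> 0" for r using v that by (simp add: radial_factor_def)
  obtain v' where v': "\<And>r. r \<ge> 0 \<Longrightarrow> (v has_real_derivative v' r) (at r within {0..})"
    using v unfolding radial_factor_def C2_right_def by blast
  have vcont: "continuous_on {0..} v"
    by (rule DERIV_continuous_on[of _ _ v']) (use v' in auto)
  define J where "J s = s ^ (n - 1) * (f s / v s) powr p" for s
  have Jcont: "continuous_on {0..} J"
    unfolding J_def using pos vpos
    by (intro continuous_intros cont vcont) (auto simp: less_imp_neq[symmetric])
  define I where "I r = integral {0..r} J" for r
  have Jint: "J integrable_on {0..r}" for r
    by (intro integrable_continuous_real continuous_on_subset[OF Jcont]) auto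
  have dI: "(I has_real_derivative J r) (at r)" if "r > 0" for r
  proof -
    have "((\<lambda>r. integral {0..r} J) has_real_derivative J r) (at r within {0..r + 1})"
      using that by (intro integral_has_real_derivative continuous_on_subset[OF Jcont]) auto
    then show ?thesis using that unfolding I_def by (simp add: at_within_Icc_at)
  qed
  have Ipos: "I r > 0" if "r > 0" for r
  proof -
    have "I 0 < I r"
    proof (rule DERIV_pos_imp_increasing_open[OF that])
      fix s assume "0 < s" "s < r"
      then have "J s > 0" using pos[of s] vpos[of s] by (simp add: J_def)
      then show "\<exists>y. (I has_real_derivative y) (at s) \<and> 0 < y" using dI[OF \<open>0 < s\<close>] by blast
    next
      show "continuous_on {0..r} I" unfolding I_def by (intro indefinite_integral_continuous_1 Jint)
    qed
    then show ?thesis by (simp add: I_def)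
  qed
  have dv: "(v has_real_derivative (c * r powr (real k - real n) * I r) powr (1 / real k)) (at r)"
    if "r > 0" for r
    using v that unfolding radial_factor_def by (simp add: c_def I_def J_def[abs_def] p_def)
  define X where "X t = v (exp t) * exp (- \<gamma> * t) / C" for t
  define Y where "Y t = c * I (exp t) * exp (- \<delta> * t) / D" for t
  define H where "H t = h (exp t) / F" for t
  (* Q solves Q' + Q = H - 1 and tends to 0 because the bracket is bounded *)
  define Q where "Q t = exp (- t) * (integral {0..exp t} h - exp t * F) / F" for t
  have vX: "v (exp t) = C * exp (\<gamma> * t) * X t" for t
    using \<open>C > 0\<close> by (simp add: X_def exp_minus)
  have IY: "c * I (exp t) = D * exp (\<delta> * t) * Y t" for t
    using \<open>D > 0\<close> by (simp add: Y_def exp_minus)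
  have Xpos: "X t > 0" for t using vpos[of "exp t"] \<open>C > 0\<close> by (simp add: X_def)
  have Ypos: "Y t > 0" for t using Ipos[of "exp t"] \<open>c > 0\<close> \<open>D > 0\<close> by (simp add: Y_def)
  have "(X \<longlongrightarrow> 1) at_top"
  proof (rule oscillating_power_loop_tendsto[where ?t0.0 = 0 and X = X and Y = Y and H = H and Q = Q
        and \<gamma> = \<gamma> and \<delta> = \<delta> and p = p and \<kappa> = "1 / real k" and hl = "hl / F" and hu = "hu / F"])
    fix t :: real
    show "X t > 0" "Y t > 0" by (rule Xpos Ypos)+
    show "(X has_real_derivative \<gamma> * (Y t powr (1 / real k) - X t)) (at t)"
    proof -
      have "(c * exp t powr (real k - real n) * I (exp t)) = exp ((real k - real n) * t) * (D * exp (\<delta> * t) * Y t)"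
        unfolding IY[symmetric] by (simp add: powr_def mult_ac)
      also have "\<dots> = exp (real k * (\<gamma> - 1) * t) * (D * Y t)"
      proof -
        have e: "(real k - real n) * t + \<delta> * t = real k * (\<gamma> - 1) * t"
        proof -
          have "real k - real n + \<delta> = real k * (\<gamma> - 1)" using pk by (simp add: \<delta>_def algebra_simps)
          then show ?thesis by (simp only: distrib_right[symmetric])
        qed
        show ?thesis unfolding e[symmetric] exp_add by (simp add: mult_ac)
      qed
      finally have slope: "(c * exp t powr (real k - real n) * I (exp t)) powr (1 / real k)
          = exp ((\<gamma> - 1) * t) * (C * \<gamma>) * Y t powr (1 / real k)"
        using \<open>D > 0\<close> Ypos[of t] k0 by (simp add: powr_mult D_root) (simp add: powr_def)
      have "((\<lambda>t. v (exp t)) has_real_derivative (exp ((\<gamma> - 1) * t) * (C * \<gamma>) * Y t powr (1 / real k)) * exp t) (at t)"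
        unfolding slope[symmetric] by (rule DERIV_chain2[OF dv DERIV_exp]) simp
      then have "(X has_real_derivative ((exp ((\<gamma> - 1) * t) * (C * \<gamma>) * Y t powr (1 / real k)) * exp t * exp (- \<gamma> * t)
          + v (exp t) * (exp (- \<gamma> * t) * (- \<gamma>))) / C) (at t)"
        unfolding X_def using \<open>C > 0\<close> by (auto intro!: derivative_eq_intros)
      also have "((exp ((\<gamma> - 1) * t) * (C * \<gamma>) * Y t powr (1 / real k)) * exp t * exp (- \<gamma> * t)
          + v (exp t) * (exp (- \<gamma> * t) * (- \<gamma>))) / C
          = \<gamma> * (exp ((\<gamma> - 1) * t) * exp t * exp (- \<gamma> * t)) * Y t powr (1 / real k) - \<gamma> * X t"
        using \<open>C > 0\<close> by (simp add: X_def field_simps)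
      also have "exp ((\<gamma> - 1) * t) * exp t * exp (- \<gamma> * t) = 1"
        by (simp add: algebra_simps flip: exp_add)
      finally show ?thesis by (simp add: algebra_simps)
    qed
    show "(Y has_real_derivative \<delta> * (H t * X t powr - p - Y t)) (at t)"
    proof -
      have dIe: "((\<lambda>t. I (exp t)) has_real_derivative J (exp t) * exp t) (at t)"
        by (rule DERIV_chain2[OF dI DERIV_exp]) simp
      have "(Y has_real_derivative (c * (J (exp t) * exp t) * exp (- \<delta> * t)
          + c * I (exp t) * (exp (- \<delta> * t) * (- \<delta>))) / D) (at t)"
        unfolding Y_def using \<open>D > 0\<close> by (auto intro!: derivative_eq_intros dIe)
      also have "(c * (J (exp t) * exp t) * exp (- \<delta> * t)
          + c * I (exp t) * (exp (- \<delta> * t) * (- \<delta>))) / D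
          = c * (J (exp t) * exp t * exp (- \<delta> * t)) / D - \<delta> * Y t"
        using \<open>D > 0\<close> by (simp add: Y_def field_simps)
      also have "J (exp t) * exp t * exp (- \<delta> * t) = h (exp t) * C powr - p * X t powr - p"
      proof -
        have "exp t ^ (n - 1) * exp t = exp (real n * t)"
          using kn by (simp add: exp_of_nat_mult flip: power_Suc2)
        then have "J (exp t) * exp t * exp (- \<delta> * t)
            = (f (exp t) / v (exp t)) powr p * (exp (real n * t) * exp (- \<delta> * t))"
          by (simp add: J_def mult_ac)
        also have "exp (real n * t) * exp (- \<delta> * t) = exp (p * \<gamma> * t)"
          by (simp add: \<delta>_def algebra_simps flip: exp_add)
        also have "(f (exp t) / v (exp t)) powr p = h (exp t) * v (exp t) powr - p"
          using pos[of "exp t"] vpos[of "exp t"]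
          by (simp add: h_def powr_divide powr_minus_divide)
        also have "v (exp t) powr - p = C powr - p * exp (- (p * \<gamma> * t)) * X t powr - p"
          unfolding vX using \<open>C > 0\<close> Xpos[of t] by (simp add: powr_mult) (simp add: powr_def)
        finally show ?thesis by (simp add: exp_minus)
      qed
      also have "c * (h (exp t) * C powr - p * X t powr - p) / D = \<delta> * H t * X t powr - p"
      proof -
        have c: "c = \<delta> * D * C powr p / F" using cF \<open>F > 0\<close> by (simp add: field_simps)
        show ?thesis unfolding H_def c using \<open>C > 0\<close> \<open>D > 0\<close>
          by (simp add: powr_minus field_simps)
      qed
      finally show ?thesis by (simp add: algebra_simps)
    qed
    show "(Q has_real_derivative H t - 1 - Q t) (at t)"
    proof -
      have "((\<lambda>r. integral {0..r} h) has_real_derivative h (exp t)) (at (exp t) within {0..exp t + 1})"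
        by (intro integral_has_real_derivative continuous_on_subset[OF hcont]) auto
      then have "((\<lambda>r. integral {0..r} h) has_real_derivative h (exp t)) (at (exp t))"
        by (simp add: at_within_Icc_at)
      then have "((\<lambda>t. integral {0..exp t} h) has_real_derivative h (exp t) * exp t) (at t)"
        by (rule DERIV_chain2[OF _ DERIV_exp])
      then have "(Q has_real_derivative ((exp (- t) * (- 1)) * (integral {0..exp t} h - exp t * F)
          + exp (- t) * (h (exp t) * exp t - exp t * F)) / F) (at t)"
        unfolding Q_def using \<open>F > 0\<close> by (auto intro!: derivative_eq_intros simp: field_simps)
      also have "((exp (- t) * (- 1)) * (integral {0..exp t} h - exp t * F)
          + exp (- t) * (h (exp t) * exp t - exp t * F)) / F = H t - 1 - Q t"
        using \<open>F > 0\<close> by (simp add: Q_def H_def exp_minus field_simps)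
      finally show ?thesis .
    qed
    show "hl / F \<le> H t" "H t \<le> hu / F"
      using hlu \<open>F > 0\<close> by (auto simp: H_def divide_right_mono)
  next
    show "(Q \<longlongrightarrow> 0) at_top"
    proof (rule Lim_null_comparison)
      show "eventually (\<lambda>t. norm (Q t) \<le> exp (- t) * B / F) at_top"
        using B \<open>F > 0\<close> by (intro always_eventually allI) (auto simp: Q_def abs_mult intro!: divide_right_mono mult_left_mono)
      have "((\<lambda>t::real. exp (- t)) \<longlongrightarrow> 0) at_top"
        by (rule filterlim_compose[OF exp_at_bot filterlim_uminus_at_bot_at_top])
      then show "((\<lambda>t. exp (- t) * B / F) \<longlongrightarrow> 0) at_top"
        using tendsto_mult_left_zero[where c = "B / F"] by fastforce
    qed
  qed (use \<open>\<gamma> > 0\<close> \<open>\<delta> > 0\<close> \<open>p > 0\<close> k0 \<open>F > 0\<close> hlu in auto)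
  then have lim: "((\<lambda>r. X (ln r)) \<longlongrightarrow> 1) at_top" by (rule filterlim_compose[OF _ ln_at_top])
  have "((\<lambda>r. C * (X (ln r) - 1)) \<longlongrightarrow> C * (1 - 1)) at_top"
    by (intro tendsto_intros lim)
  then have lim0: "((\<lambda>r. C * (X (ln r) - 1)) \<longlongrightarrow> 0) at_top" by simp
  show ?thesis
  proof (rule smalloI_tendsto)
    show "((\<lambda>r. (v r - C * r powr \<gamma>) / r powr \<gamma>) \<longlongrightarrow> 0) at_top"
    proof (rule Lim_transform_eventually[OF lim0])
      show "\<forall>\<^sub>F r in at_top. C * (X (ln r) - 1) = (v r - C * r powr \<gamma>) / r powr \<gamma>"
        using eventually_gt_at_top[of 0]
      proof eventually_elim
        case (elim r)
        have "v r = C * r powr \<gamma> * X (ln r)" using vX[of "ln r"] elim by (simp add: powr_def)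
        then show ?case using elim by (simp add: field_simps)
      qed
    qed
    show "\<forall>\<^sub>F r::real in at_top. r powr \<gamma> \<noteq> 0"
      using eventually_gt_at_top[of 0] by eventually_elim simp
  qed
qed

section \<open>Asymptotics of the separable solution\<close>

theorem theorem1p5:
  "\<exists>(Cw :: nat \<Rightarrow> real \<Rightarrow> (real \<Rightarrow> real) \<Rightarrow> real)
    (Cv :: nat \<Rightarrow> nat \<Rightarrow> real \<Rightarrow> (real \<Rightarrow> real) \<Rightarrow> real).
   \<forall>(n :: nat) (k :: nat) (\<alpha> :: real) (f :: real \<Rightarrow> real) (g :: real \<Rightarrow> real) (Tf :: real) (Tg :: real).
     1 \<le> k \<and> k \<le> n \<and>
     continuous_on {0..} f \<and> (\<forall>r\<ge>0. f r > 0) \<and> minimal_period_right f Tf \<and>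
     continuous_on {..0} g \<and> (\<forall>t\<le>0. g t > 0) \<and> minimal_period_left g Tg \<and>
     \<alpha> > max 0 ((2 * real k - real n) / (real k * real n))
     \<longrightarrow>
     (\<lambda>t. time_factor k \<alpha> g t
           - Cw k \<alpha> (restrict g {..0}) * (- t) powr (1 / (real k * \<alpha> + 1)))
       \<in> O[at_bot](\<lambda>t. (- t) powr (1 / (real k * \<alpha> + 1) - 1)) \<and>
     (\<forall>v. radial_factor n k \<alpha> f v \<longrightarrow>
       (\<lambda>r. v r
             - Cv n k \<alpha> (restrict f {0..}) * r powr (2 * real k * \<alpha> / (real k * \<alpha> + 1)))
         \<in> o[at_top](\<lambda>r. r powr (2 * real k * \<alpha> / (real k * \<alpha> + 1))))"
proof -
  define \<gamma> where "\<gamma> k \<alpha> = 2 * real k * \<alpha> / (real k * \<alpha> + 1)" for k :: nat and \<alpha> :: real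
  define Cw where "Cw k \<alpha> g = ((real k * \<alpha> + 1) * half_line_mean (\<lambda>s. g (- s))) powr (1 / (real k * \<alpha> + 1))"
    for k :: nat and \<alpha> and g :: "real \<Rightarrow> real"
  define Cv where "Cv n k \<alpha> f = (real n / real (n choose k) * half_line_mean (\<lambda>s. f s powr (1 / \<alpha>))
      / ((real n - \<gamma> k \<alpha> / \<alpha>) * \<gamma> k \<alpha> ^ k)) powr (1 / (real k + 1 / \<alpha>))"
    for n k :: nat and \<alpha> and f :: "real \<Rightarrow> real"
  have Cw: "Cw k \<alpha> (restrict g {..0}) = Cw k \<alpha> g" for k \<alpha> g
    unfolding Cw_def by (subst half_line_mean_cong[where ?h2.0 = "\<lambda>s. g (- s)"]) auto
  have Cv: "Cv n k \<alpha> (restrict f {0..}) = Cv n k \<alpha> f" for n k \<alpha> f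
    unfolding Cv_def by (subst half_line_mean_cong[where ?h2.0 = "\<lambda>s. f s powr (1 / \<alpha>)"]) auto
  show ?thesis
  proof (rule exI[of _ Cw], rule exI[of _ Cv], unfold Cw Cv, intro allI impI conjI; elim conjE)
    fix n k :: nat and \<alpha> :: real and f g :: "real \<Rightarrow> real" and Tf Tg :: real
    assume "1 \<le> k" "k \<le> n" "max 0 ((2 * real k - real n) / (real k * real n)) < \<alpha>"
      and f: "continuous_on {0..} f" "\<forall>r\<ge>0. 0 < f r" "minimal_period_right f Tf"
      and g: "continuous_on {..0} g" "\<forall>t\<le>0. 0 < g t" "minimal_period_left g Tg"
    then have \<alpha>: "\<alpha> > 0" "\<alpha> > (2 * real k - real n) / (real k * real n)" by auto
    show "(\<lambda>t. time_factor k \<alpha> g t - Cw k \<alpha> g * (- t) powr (1 / (real k * \<alpha> + 1)))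
        \<in> O[at_bot](\<lambda>t. (- t) powr (1 / (real k * \<alpha> + 1) - 1))"
      unfolding Cw_def using g
      by (intro time_factor_asymptotics \<open>1 \<le> k\<close> \<alpha>(1)) (auto simp: minimal_period_left_def)
    fix v assume v: "radial_factor n k \<alpha> f v"
    show "(\<lambda>r. v r - Cv n k \<alpha> f * r powr (2 * real k * \<alpha> / (real k * \<alpha> + 1)))
        \<in> o[at_top](\<lambda>r. r powr (2 * real k * \<alpha> / (real k * \<alpha> + 1)))"
      unfolding Cv_def \<gamma>_def using f
      by (intro radial_factor_asymptotics[OF \<open>1 \<le> k\<close> \<open>k \<le> n\<close> \<alpha> _ _ _ v]) (auto simp: minimal_period_right_def)
  qed
qed

end
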